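(* Let $\mathcal{Q}$ be a thick finite generalized quadrangle of order $(s,t)$, where $s > t$ and $s+1$ is prime. If $\mathcal{Q}$ has an automorphism of order $s+1$, then \[ s \left\lceil \left\lceil \frac{t^2}{s+1}\right\rceil\left(\frac{s+1}{t} \right) \right\rceil \le t(s+t).\]
   Context: A finite generalized quadrangle of order $(s,t)$, with $s,t$ positive integers, is an incidence structure consisting of a finite set $\mathcal{P}$ of points, a finite set $\mathcal{L}$ of lines disjoint from $\mathcal{P}$, and a symmetric point-line incidence relation such that: each point is incident with exactly $t+1$ lines and each line is incident with exactly $s+1$ points; two distinct points are mutually incident with at most one line, and two distinct lines are mutually incident with at most one point; and for each point $P$ and each line $\ell$ not incident with $P$ there is a unique pair $(P',\ell') \in \mathcal{P}\times\mathcal{L}$ such that $P$ is incident with $\ell'$, $\ell'$ is incident with $P'$, and $P'$ is incident with $\ell$. It is thick if $s>1$ and $t>1$. An automorphism of $\mathcal{Q}$ is a permutation of the point set that preserves collinearity (two points are collinear if some line is incident with both); it induces a permutation of the lines preserving incidence. The order of an automorphism is its order as an element of the automorphism group. *)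

theory Defs
  imports
    Complex_Main
    "HOL-Computational_Algebra.Primes"
    "HOL-Algebra.Bij"
    "HOL-Algebra.Multiplicative_Group"
begin

text \<open>
  Points and lines live in two separate types, so they are disjoint by construction, and the
  symmetric incidence relation is represented by its point-line half \<open>I\<close>.
\<close>

locale finite_generalized_quadrangle =
  fixes P :: "'p set" and L :: "'l set" and I :: "('p \<times> 'l) set" and s t :: nat
  assumes finite_points: "finite P"
    and finite_lines: "finite L"
    and incidence: "I \<subseteq> P \<times> L"
    and s_pos: "0 < s"
    and t_pos: "0 < t"
    and lines_on_point: "\<And>x. x \<in> P \<Longrightarrow> card {l \<in> L. (x, l) \<in> I} = t + 1"
    and points_on_line: "\<And>l. l \<in> L \<Longrightarrow> card {x \<in> P. (x, l) \<in> I} = s + 1"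
    and two_points: "\<And>x y. x \<in> P \<Longrightarrow> y \<in> P \<Longrightarrow> x \<noteq> y \<Longrightarrow>
          card {l \<in> L. (x, l) \<in> I \<and> (y, l) \<in> I} \<le> 1"
    and two_lines: "\<And>l m. l \<in> L \<Longrightarrow> m \<in> L \<Longrightarrow> l \<noteq> m \<Longrightarrow>
          card {x \<in> P. (x, l) \<in> I \<and> (x, m) \<in> I} \<le> 1"
    and unique_projection: "\<And>x l. x \<in> P \<Longrightarrow> l \<in> L \<Longrightarrow> (x, l) \<notin> I \<Longrightarrow>
          \<exists>!(y, m). y \<in> P \<and> m \<in> L \<and> (x, m) \<in> I \<and> (y, m) \<in> I \<and> (y, l) \<in> I"

locale thick_finite_generalized_quadrangle = finite_generalized_quadrangle +
  assumes s_gt_1: "1 < s" and t_gt_1: "1 < t"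

definition collinear_points :: "'l set \<Rightarrow> ('p \<times> 'l) set \<Rightarrow> 'p \<Rightarrow> 'p \<Rightarrow> bool" where
  "collinear_points L I x y \<longleftrightarrow> (\<exists>l\<in>L. (x, l) \<in> I \<and> (y, l) \<in> I)"

text \<open>
  On a finite point set, a permutation mapping collinear pairs to collinear pairs also
  reflects collinearity; the equivalence makes the automorphisms a group in general.
\<close>

definition gq_automorphisms :: "'p set \<Rightarrow> 'l set \<Rightarrow> ('p \<times> 'l) set \<Rightarrow> ('p \<Rightarrow> 'p) set" where
  "gq_automorphisms P L I = {g \<in> Bij P. \<forall>x\<in>P. \<forall>y\<in>P.
     collinear_points L I (g x) (g y) \<longleftrightarrow> collinear_points L I x y}"

definition gq_AutoGroup :: "'p set \<Rightarrow> 'l set \<Rightarrow> ('p \<times> 'l) set \<Rightarrow> ('p \<Rightarrow> 'p) monoid" where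
  "gq_AutoGroup P L I = BijGroup P \<lparr>carrier := gq_automorphisms P L I\<rparr>"

lemma subgroup_gq_automorphisms: "subgroup (gq_automorphisms P L I) (BijGroup P)"
proof (rule subgroup.intro)
  show "gq_automorphisms P L I \<subseteq> carrier (BijGroup P)"
    by (auto simp: gq_automorphisms_def BijGroup_def)
next
  fix f g assume "f \<in> gq_automorphisms P L I" "g \<in> gq_automorphisms P L I"
  moreover from this have "g x \<in> P" if "x \<in> P" for x
    using that by (auto simp: gq_automorphisms_def dest: Bij_imp_funcset)
  ultimately show "f \<otimes>\<^bsub>BijGroup P\<^esub> g \<in> gq_automorphisms P L I"
    by (simp add: gq_automorphisms_def BijGroup_def compose_Bij compose_eq)
next
  show "\<one>\<^bsub>BijGroup P\<^esub> \<in> gq_automorphisms P L I"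
    by (simp add: gq_automorphisms_def BijGroup_def id_Bij)
next
  fix f assume f: "f \<in> gq_automorphisms P L I"
  then have B: "f \<in> Bij P" by (simp add: gq_automorphisms_def)
  have "collinear_points L I (inv_into P f x) (inv_into P f y) \<longleftrightarrow> collinear_points L I x y"
    if "x \<in> P" "y \<in> P" for x y
  proof -
    have "f (inv_into P f x) = x" "f (inv_into P f y) = y"
      using B that by (auto simp: Bij_def bij_betw_inv_into_right)
    moreover have "inv_into P f x \<in> P" "inv_into P f y \<in> P"
      using B that by (auto simp: Bij_inv_into_mem)
    ultimately show ?thesis
      using f unfolding gq_automorphisms_def by fastforce
  qed
  then show "inv\<^bsub>BijGroup P\<^esub> f \<in> gq_automorphisms P L I"
    using B by (simp add: gq_automorphisms_def inv_BijGroup restrict_inv_into_Bij)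
qed

lemma group_gq_AutoGroup: "group (gq_AutoGroup P L I)"
  unfolding gq_AutoGroup_def
  by (rule subgroup.subgroup_is_group[OF subgroup_gq_automorphisms group_BijGroup])

end

theory Submission
  imports Defs "HOL-Number_Theory.Cong"
begin

text \<open>
  Let \<open>p = s + 1\<close> and let \<open>g\<close> be the automorphism of order \<open>p\<close>. Its orbits have size \<open>1\<close> or \<open>p\<close>.

  There are no fixed points: the \<open>t + 1 < p\<close> lines on a fixed point are too few to contain an
  orbit of size \<open>p\<close>, so all of them are fixed, and then so are the \<open>s < p\<close> further points of each
  of them; as any point is joined to a given line, \<open>g\<close> would be trivial
  (\<open>fixed_point_spreads\<close>, \<open>no_fixed_point\<close>). Consequently distinct fixed lines are disjoint. Let
  \<open>F\<close> be their number. Since there are \<open>(t + 1) (s t + 1)\<close> lines, \<open>F \<equiv> 1 - t\<^sup>2\<close> modulo \<open>p\<close>, so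
  \<open>F = k p + 1 - t\<^sup>2\<close> for some \<open>k\<close>; moreover \<open>F > 0\<close> because \<open>p\<close> does not divide
  \<open>(t - 1) (t + 1)\<close>. Hence \<open>t\<^sup>2 \<le> k p\<close>.

  For the upper bound on \<open>F\<close>, take a point \<open>x\<close> on a fixed line \<open>l0\<close>. Each of the \<open>F - 1\<close> other
  fixed lines meets one of the \<open>t\<close> other lines on \<open>x\<close>, so one of these, say \<open>m\<close>, meets \<open>n\<close> of
  them with \<open>F - 1 \<le> t n\<close>. The \<open>s + 1\<close> images of \<open>m\<close> are pairwise disjoint, and each of them
  meets \<open>l0\<close> and the same \<open>n\<close> other fixed lines: this is a grid of \<open>s + 1\<close> by \<open>n + 1\<close> lines. The
  dual of an inequality of Payne and Thas (\<open>grid_inequality\<close>) gives \<open>s n \<le> t\<^sup>2\<close>.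

  Altogether \<open>t\<^sup>2 \<le> k p \<le> t (t + n)\<close>, so the inner ceiling is at most \<open>k\<close> and the outer one at
  most \<open>t + n\<close>, and \<open>s (t + n) \<le> s t + t\<^sup>2\<close>.

  The grid inequality is an eigenvalue bound in elementary dress. The matrix \<open>B\<close> whose entries
  count the common points of two lines satisfies \<open>B\<^sup>2 = (s + t) B + (s + 1) J\<close>, where \<open>J\<close> is the
  all-ones matrix (\<open>sum_meets_meets\<close>). So apart from its constant eigenvector, \<open>B\<close> has only the
  eigenvalues \<open>0\<close> and \<open>s + t\<close>, which bounds its quadratic form from above
  (\<open>meets_form_bound\<close>); a suitable combination of the indicators of the two classes of lines of
  the grid gives the inequality.
\<close>

section \<open>Maps of prime period\<close>

text \<open>
  If \<open>x\<close> came back after \<open>k < p\<close> steps, then choosing \<open>a\<close> with \<open>k a \<equiv> 1\<close> modulo \<open>p\<close>, it would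
  come back after a single step.
\<close>

lemma inj_on_funpow_prime_period:
  assumes p: "Factorial_Ring.prime (p::nat)" and per: "(f ^^ p) x = x" and move: "f x \<noteq> x"
  shows "inj_on (\<lambda>i. (f ^^ i) x) {..<p}"
proof -
  have no_return: "(f ^^ k) x \<noteq> x" if k: "0 < k" "k < p" for k
  proof
    assume ret: "(f ^^ k) x = x"
    have "\<not> p dvd k"
      using k by (auto dest: dvd_imp_le)
    then have "coprime k p"
      using prime_imp_coprime[OF p] by (simp add: coprime_commute)
    then obtain a where a: "[k * a = 1] (mod p)"
      using cong_solve_coprime_nat[of k p] by auto
    have iter: "(f ^^ (n * m)) x = x" if "(f ^^ n) x = x" for n m
      using that funpow_mod_eq[of n f x "n * m"] by simp
    have "f x = (f ^^ 1) x" by simp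
    also have "\<dots> = (f ^^ (1 mod p)) x"
      by (simp only: funpow_mod_eq[OF per])
    also have "\<dots> = (f ^^ (k * a mod p)) x"
      using a by (simp add: cong_def)
    also have "\<dots> = x"
      by (simp only: funpow_mod_eq[OF per] iter[OF ret])
    finally show False using move by simp
  qed
  have no_collision: "(f ^^ i) x \<noteq> (f ^^ j) x" if ij: "i < j" "j < p" for i j
  proof
    assume "(f ^^ i) x = (f ^^ j) x"
    have add_iter: "(f ^^ m) ((f ^^ n) x) = (f ^^ (m + n)) x" for m n
      by (simp add: funpow_add)
    from \<open>(f ^^ i) x = (f ^^ j) x\<close>
    have "(f ^^ (p - i)) ((f ^^ i) x) = (f ^^ (p - i)) ((f ^^ j) x)" by simp
    moreover have "(f ^^ (p - i)) ((f ^^ i) x) = x"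
      using ij per by (simp add: add_iter)
    moreover have "(f ^^ (p - i)) ((f ^^ j) x) = (f ^^ (j - i)) x"
    proof -
      have "(f ^^ (p - i)) ((f ^^ j) x) = (f ^^ ((j - i) + p)) x"
        using ij by (simp add: add_iter add.commute)
      then show ?thesis using per by (simp add: funpow_add)
    qed
    ultimately show False using no_return[of "j - i"] ij by (simp add: less_imp_diff_less)
  qed
  show ?thesis
  proof (rule linorder_inj_onI)
    show "(f ^^ i) x \<noteq> (f ^^ j) x" if "i < j" "i \<in> {..<p}" "j \<in> {..<p}" for i j
      using no_collision that by simp
  qed auto
qed

lemma funpow_closed:
  assumes "\<And>x. x \<in> S \<Longrightarrow> f x \<in> S" "x \<in> S"
  shows "(f ^^ n) x \<in> S"
  using assms by (induction n) auto

text \<open>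
  The points that move fall into orbits of size \<open>p\<close>; the induction removes one orbit at a time.
\<close>

lemma card_fixed_cong_card:
  assumes p: "Factorial_Ring.prime (p::nat)" and fin: "finite S"
    and closed: "\<And>x. x \<in> S \<Longrightarrow> f x \<in> S"
    and per: "\<And>x. x \<in> S \<Longrightarrow> (f ^^ p) x = x"
  shows "[card {x \<in> S. f x = x} = card S] (mod p)"
  using fin closed per
proof (induction "card S" arbitrary: S rule: less_induct)
  case less
  show ?case
  proof (cases "\<exists>x\<in>S. f x \<noteq> x")
    case False
    then have "{x \<in> S. f x = x} = S" by blast
    then show ?thesis by simp
  next
    case True
    then obtain x where x: "x \<in> S" "f x \<noteq> x" by blast
    have p0: "0 < p" using p by (simp add: prime_gt_0_nat)
    define orb where "orb = (\<lambda>i. (f ^^ i) x) ` {..<p}"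
    have card_orb: "card orb = p"
      unfolding orb_def
      using card_image[OF inj_on_funpow_prime_period[OF p less.prems(3)[OF x(1)] x(2)]] by simp
    have orb_sub: "orb \<subseteq> S"
      unfolding orb_def using funpow_closed[of S f x, OF less.prems(2) x(1)] by blast
    have in_orb: "(f ^^ i) x \<in> orb" for i
    proof -
      have "(f ^^ i) x = (f ^^ (i mod p)) x"
        by (simp only: funpow_mod_eq[OF less.prems(3)[OF x(1)]])
      then show ?thesis unfolding orb_def using p0 by simp
    qed
    have into_orb: "y \<in> orb" if y: "y \<in> S" and fy: "f y \<in> orb" for y
    proof -
      obtain i where i: "f y = (f ^^ i) x" using fy unfolding orb_def by auto
      have "y = (f ^^ (Suc (p - 1))) y" using less.prems(3)[OF y] p0 by simp
      also have "\<dots> = (f ^^ (p - 1)) (f y)" by (simp add: funpow_swap1)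
      also have "\<dots> = (f ^^ ((p - 1) + i)) x" by (simp add: i funpow_add)
      finally show ?thesis using in_orb by metis
    qed
    have move_orb: "f y \<noteq> y" if y: "y \<in> orb" for y
    proof
      assume fy: "f y = y"
      obtain i where i: "i < p" "y = (f ^^ i) x" using y unfolding orb_def by auto
      have stay: "(f ^^ n) y = y" for n by (induction n) (auto simp: fy)
      have "x = (f ^^ (p - i + i)) x" using less.prems(3)[OF x(1)] i by simp
      also have "\<dots> = (f ^^ (p - i)) y" by (simp add: i(2) funpow_add)
      also have "\<dots> = y" by (rule stay)
      finally show False using x(2) fy by simp
    qed
    have "card (S - orb) < card S"
      using less.prems(1) orb_sub in_orb[of 0]
      by (intro psubset_card_mono) (auto simp: card_gt_0_iff)
    then have "[card {y \<in> S - orb. f y = y} = card (S - orb)] (mod p)"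
      using less.prems into_orb by (intro less.hyps) auto
    moreover have "{y \<in> S - orb. f y = y} = {y \<in> S. f y = y}" using move_orb by auto
    moreover have "card S = card (S - orb) + p"
      using card_mono[OF less.prems(1) orb_sub] less.prems(1) orb_sub card_orb
      by (simp add: card_Diff_subset finite_subset)
    ultimately show ?thesis by (simp add: cong_def)
  qed
qed

text \<open>
  A moving point would need an orbit of \<open>p\<close> elements inside the set.
\<close>

lemma small_invariant_set_fixed:
  assumes p: "Factorial_Ring.prime (p::nat)" and fin: "finite S" and small: "card S < p"
    and closed: "\<And>x. x \<in> S \<Longrightarrow> f x \<in> S"
    and per: "\<And>x. x \<in> S \<Longrightarrow> (f ^^ p) x = x"
    and x: "x \<in> S"
  shows "f x = x"
proof (rule ccontr)
  assume move: "f x \<noteq> x"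
  have "(\<lambda>i. (f ^^ i) x) ` {..<p} \<subseteq> S"
    by (intro image_subsetI funpow_closed closed x)
  from card_mono[OF fin this] have "p \<le> card S"
    by (simp add: card_image[OF inj_on_funpow_prime_period[OF p per[OF x] move]])
  with small show False by simp
qed

section \<open>Counting with common points of lines\<close>

context finite_generalized_quadrangle
begin

definition pts :: "'l \<Rightarrow> 'p set" where
  "pts l = {x \<in> P. (x, l) \<in> I}"

definition pencil :: "'p \<Rightarrow> 'l set" where
  "pencil x = {l \<in> L. (x, l) \<in> I}"

definition meets :: "'l \<Rightarrow> 'l \<Rightarrow> nat" where
  "meets l m = card (pts l \<inter> pts m)"

lemma pts_subset: "pts l \<subseteq> P"
  by (auto simp: pts_def)

lemma finite_pts [simp]: "finite (pts l)"
  using finite_points by (simp add: pts_def)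

lemma finite_pencil [simp]: "finite (pencil x)"
  using finite_lines by (simp add: pencil_def)

lemma card_pts: "l \<in> L \<Longrightarrow> card (pts l) = s + 1"
  by (simp add: pts_def points_on_line)

lemma card_pencil: "x \<in> P \<Longrightarrow> card (pencil x) = t + 1"
  by (simp add: pencil_def lines_on_point)

lemma mem_pencil_iff: "x \<in> P \<Longrightarrow> l \<in> L \<Longrightarrow> l \<in> pencil x \<longleftrightarrow> x \<in> pts l"
  by (auto simp: pts_def pencil_def)

lemma lines_eqI:
  assumes "l \<in> L" "m \<in> L" "x \<in> pts l" "x \<in> pts m" "y \<in> pts l" "y \<in> pts m" "x \<noteq> y"
  shows "l = m"
proof (rule ccontr)
  assume "l \<noteq> m"
  then have "card {x \<in> P. (x, l) \<in> I \<and> (x, m) \<in> I} \<le> 1"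
    using assms two_lines by blast
  moreover have "{x, y} \<subseteq> {x \<in> P. (x, l) \<in> I \<and> (x, m) \<in> I}"
    using assms by (auto simp: pts_def)
  ultimately have "card {x, y} \<le> 1"
    using card_mono[of "{x \<in> P. (x, l) \<in> I \<and> (x, m) \<in> I}" "{x, y}"] finite_points by simp
  then show False using assms by simp
qed

lemma two_points_on_line:
  assumes "l \<in> L"
  obtains x y where "x \<in> pts l" "y \<in> pts l" "x \<noteq> y"
proof -
  have "\<not> card (pts l) \<le> Suc 0" using card_pts[OF assms] s_pos by simp
  then show ?thesis using that card_le_Suc0_iff_eq[of "pts l"] by auto
qed

lemma pts_inj:
  assumes "l \<in> L" "m \<in> L" "pts l = pts m" shows "l = m"
proof -
  obtain x y where "x \<in> pts l" "y \<in> pts l" "x \<noteq> y"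
    using two_points_on_line[OF assms(1)] by blast
  then show ?thesis using lines_eqI[OF assms(1,2)] assms(3) by blast
qed

lemma projection_exists:
  assumes "x \<in> P" "l \<in> L" "x \<notin> pts l"
  obtains y m where "m \<in> L" "x \<in> pts m" "y \<in> pts m" "y \<in> pts l"
proof -
  have "(x, l) \<notin> I" using assms by (auto simp: pts_def)
  then obtain y m where "y \<in> P" "m \<in> L" "(x, m) \<in> I" "(y, m) \<in> I" "(y, l) \<in> I"
    using unique_projection[OF assms(1,2)] by (auto elim!: ex1E)
  then show ?thesis using assms(1) by (intro that[of m y]) (auto simp: pts_def)
qed

lemma projection_unique:
  assumes "l \<in> L" "x \<notin> pts l"
    and "m \<in> L" "x \<in> pts m" "y \<in> pts m" "y \<in> pts l"
    and "m' \<in> L" "x \<in> pts m'" "y' \<in> pts m'" "y' \<in> pts l"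
  shows "y = y' \<and> m = m'"
proof -
  have x: "x \<in> P" "(x, l) \<notin> I" using assms by (auto simp: pts_def)
  let ?Pr = "\<lambda>(y, m). y \<in> P \<and> m \<in> L \<and> (x, m) \<in> I \<and> (y, m) \<in> I \<and> (y, l) \<in> I"
  have "?Pr (y, m)" "?Pr (y', m')" using assms by (auto simp: pts_def)
  then have "(y, m) = (y', m')" using unique_projection[OF x(1) assms(1) x(2)] by blast
  then show ?thesis by simp
qed

lemma no_triangle:
  assumes "l \<in> L" "m \<in> L" "n \<in> L" "x \<in> pts l" "y \<in> pts l" "z \<in> pts m" "x \<in> pts m"
    "z \<in> pts n" "y \<in> pts n" "x \<noteq> y"
  shows "z \<in> pts l"
  using projection_unique[of l z m x n y] assms by blast

lemma collinear_points_iff: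
  "x \<in> P \<Longrightarrow> y \<in> P \<Longrightarrow> collinear_points L I x y \<longleftrightarrow> (\<exists>l\<in>L. x \<in> pts l \<and> y \<in> pts l)"
  by (auto simp: collinear_points_def pts_def)

lemma meets_commute: "meets l m = meets m l"
  by (simp add: meets_def Int_commute)

lemma meets_self: "l \<in> L \<Longrightarrow> meets l l = s + 1"
  by (simp add: meets_def card_pts)

lemma meets_distinct:
  assumes "l \<in> L" "m \<in> L" "l \<noteq> m"
  shows "meets l m = of_bool (pts l \<inter> pts m \<noteq> {})"
proof (cases "pts l \<inter> pts m = {}")
  case False
  then obtain x where x: "x \<in> pts l \<inter> pts m" by blast
  then have "pts l \<inter> pts m = {x}" using lines_eqI[OF assms(1,2)] assms(3) by blast
  then show ?thesis by (simp add: meets_def)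
qed (simp add: meets_def)

text \<open>
  The axiom of unique projection in counting form: off \<open>m\<close>, exactly one line on \<open>x\<close> meets \<open>m\<close>,
  and in one point; on \<open>m\<close>, the line \<open>m\<close> contributes \<open>s + 1\<close> and each of the \<open>t\<close> other lines
  on \<open>x\<close> contributes \<open>1\<close>.
\<close>

lemma sum_pencil_meets:
  assumes x: "x \<in> P" and m: "m \<in> L"
  shows "(\<Sum>k\<in>pencil x. meets k m) = 1 + (s + t) * of_bool (x \<in> pts m)"
proof (cases "x \<in> pts m")
  case True
  have mp: "m \<in> pencil x" using True x m by (simp add: mem_pencil_iff)
  have "(\<Sum>k\<in>pencil x. meets k m) = meets m m + (\<Sum>k\<in>pencil x - {m}. meets k m)"
    using mp by (simp add: sum.remove)
  also have "(\<Sum>k\<in>pencil x - {m}. meets k m) = (\<Sum>k\<in>pencil x - {m}. 1)"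
  proof (rule sum.cong)
    fix k assume "k \<in> pencil x - {m}"
    then have "k \<in> L" "k \<noteq> m" "x \<in> pts k \<inter> pts m"
      using True x by (auto simp: pencil_def pts_def)
    then show "meets k m = 1" using m by (auto simp: meets_distinct)
  qed simp
  also have "\<dots> = t" using mp x by (simp add: card_pencil)
  finally show ?thesis using True m by (simp add: meets_self)
next
  case False
  obtain y k where k: "k \<in> L" "x \<in> pts k" "y \<in> pts k" "y \<in> pts m"
    using projection_exists[OF x m False] by blast
  have val: "meets k' m = of_bool (k' = k)" if "k' \<in> pencil x" for k'
  proof -
    have k': "k' \<in> L" "x \<in> pts k'" using that x by (auto simp: pencil_def pts_def)
    have "pts k' \<inter> pts m \<noteq> {} \<longleftrightarrow> k' = k"
      using projection_unique[OF m False k k'] k by blast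
    moreover have "k' \<noteq> m" using k' False by blast
    ultimately show ?thesis using meets_distinct[OF k'(1) m] by simp
  qed
  have "(\<Sum>k'\<in>pencil x. meets k' m) = (\<Sum>k'\<in>pencil x. if k' = k then 1 else 0)"
    by (rule sum.cong) (auto simp: val)
  also have "\<dots> = 1" using k x by (simp add: mem_pencil_iff)
  finally show ?thesis using False by simp
qed

text \<open>
  A sum weighted by common points with \<open>l\<close> can be taken over the points of \<open>l\<close> first, which
  reduces it to sums over pencils.
\<close>

lemma sum_meets_swap:
  assumes l: "l \<in> L"
  shows "(\<Sum>k\<in>L. meets l k * h k) = (\<Sum>x\<in>pts l. \<Sum>k\<in>pencil x. h k)"
proof -
  have "(\<Sum>k\<in>L. meets l k * h k) = (\<Sum>k\<in>L. \<Sum>x\<in>pts l. of_bool (x \<in> pts k) * h k)"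
    by (rule sum.cong) (auto simp: meets_def sum_distrib_right[symmetric] of_bool_def sum.If_cases)
  also have "\<dots> = (\<Sum>x\<in>pts l. \<Sum>k\<in>L. of_bool (x \<in> pts k) * h k)"
    by (rule sum.swap)
  also have "\<dots> = (\<Sum>x\<in>pts l. \<Sum>k\<in>pencil x. h k)"
  proof (rule sum.cong)
    fix x assume "x \<in> pts l"
    then have x: "x \<in> P" using pts_subset by blast
    show "(\<Sum>k\<in>L. of_bool (x \<in> pts k) * h k) = (\<Sum>k\<in>pencil x. h k)"
      by (rule sum.mono_neutral_cong_right) (use finite_lines x in \<open>auto simp: pencil_def pts_def\<close>)
  qed simp
  finally show ?thesis .
qed

lemma sum_meets: "l \<in> L \<Longrightarrow> (\<Sum>k\<in>L. meets l k) = (s + 1) * (t + 1)"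
proof -
  assume l: "l \<in> L"
  have "(\<Sum>x\<in>pts l. \<Sum>k\<in>pencil x. 1) = (\<Sum>x\<in>pts l. t + 1)"
    using pts_subset card_pencil by (intro sum.cong) auto
  then show ?thesis using sum_meets_swap[OF l, of "\<lambda>_. 1"] card_pts[OF l] by simp
qed

text \<open>
  The matrix identity \<open>B\<^sup>2 = (s + t) B + (s + 1) J\<close> in coordinates. It leaves \<open>B\<close> only
  the eigenvalues \<open>0\<close> and \<open>s + t\<close> on functions with sum \<open>0\<close>.
\<close>

lemma sum_meets_meets:
  assumes l: "l \<in> L" and m: "m \<in> L"
  shows "(\<Sum>k\<in>L. meets l k * meets k m) = (s + t) * meets l m + (s + 1)"
proof -
  have "(\<Sum>k\<in>L. meets l k * meets k m) = (\<Sum>x\<in>pts l. 1 + (s + t) * of_bool (x \<in> pts m))"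
    unfolding sum_meets_swap[OF l]
    using pts_subset by (intro sum.cong refl sum_pencil_meets m) blast
  also have "\<dots> = card (pts l) + (s + t) * (\<Sum>x\<in>pts l. of_bool (x \<in> pts m))"
    by (simp only: sum.distrib sum_distrib_left card_eq_sum)
  also have "(\<Sum>x\<in>pts l. of_bool (x \<in> pts m)) = meets l m"
    by (simp add: meets_def of_bool_def sum.If_cases)
  finally show ?thesis using card_pts[OF l] by simp
qed

text \<open>
  Summing the identity for \<open>B\<^sup>2\<close> along a row and using that the rows of \<open>B\<close> have sum
  \<open>(s + 1) (t + 1)\<close> leaves a linear equation for the number of lines.
\<close>

lemma card_lines:
  assumes "L \<noteq> {}"
  shows "card L = (t + 1) * (s * t + 1)"
proof -
  obtain l where l: "l \<in> L" using assms by blast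
  have "(\<Sum>m\<in>L. \<Sum>k\<in>L. meets l k * meets k m) = (\<Sum>k\<in>L. meets l k * (\<Sum>m\<in>L. meets k m))"
    by (subst sum.swap) (simp add: sum_distrib_left)
  also have "\<dots> = (\<Sum>k\<in>L. meets l k) * ((s + 1) * (t + 1))"
    by (simp only: sum_meets sum_distrib_right cong: sum.cong)
  also have "\<dots> = ((s + 1) * (t + 1)) * ((s + 1) * (t + 1))"
    using sum_meets[OF l] by simp
  finally have "((s + 1) * (t + 1)) * ((s + 1) * (t + 1))
      = (\<Sum>m\<in>L. (s + t) * meets l m + (s + 1))"
    using sum_meets_meets[OF l] by simp
  also have "\<dots> = (s + t) * (\<Sum>m\<in>L. meets l m) + (s + 1) * card L"
    by (simp only: sum.distrib sum_distrib_left sum_constant) simp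
  also have "\<dots> = (s + t) * ((s + 1) * (t + 1)) + (s + 1) * card L"
    using sum_meets[OF l] by simp
  finally have "(s + 1) * (s * t * (t + 1) + (t + 1) + (s + t) * (t + 1))
      = (s + 1) * ((s + t) * (t + 1) + card L)"
    by (simp add: algebra_simps)
  then have "s * t * (t + 1) + (t + 1) + (s + t) * (t + 1) = (s + t) * (t + 1) + card L"
    by (metis add_eq_0_iff_both_eq_0 mult_left_cancel one_neq_zero)
  then show ?thesis by (simp add: algebra_simps)
qed

section \<open>The grid inequality\<close>

text \<open>
  With \<open>\<sigma> = s + t\<close>, the operator \<open>M = \<sigma> - B + J / (t + 1)\<close> kills the constant functions and
  the eigenspace of \<open>B\<close> for \<open>\<sigma>\<close>, and acts as \<open>\<sigma>\<close> on the kernel of \<open>B\<close>. So \<open>M\<^sup>2 = \<sigma> M\<close>, and its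
  quadratic form is nonnegative because \<open>\<sigma>\<close> times its value at \<open>f\<close> is the square sum of \<open>M f\<close>.
  Multiplied by \<open>t + 1\<close>, this is the inequality.
\<close>

lemma meets_form_bound:
  fixes f :: "'l \<Rightarrow> real"
  assumes "L \<noteq> {}"
  shows "(t + 1) * (\<Sum>l\<in>L. f l * (\<Sum>k\<in>L. meets l k * f k))
    \<le> (t + 1) * (s + t) * (\<Sum>l\<in>L. (f l)\<^sup>2) + (\<Sum>l\<in>L. f l)\<^sup>2"
proof -
  define h where "h l = (\<Sum>k\<in>L. real (meets l k) * f k)" for l
  define S where "S = (\<Sum>l\<in>L. f l)"
  define Q where "Q = (\<Sum>l\<in>L. f l * h l)"
  define N where "N = (\<Sum>l\<in>L. (f l)\<^sup>2)"
  define \<sigma> where "\<sigma> = real (s + t)"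
  define \<tau> where "\<tau> = real (t + 1)"
  define \<rho> where "\<rho> = real (s + 1)"
  have pos: "0 < \<sigma>" "0 < \<tau>" using s_pos by (simp_all add: \<sigma>_def \<tau>_def)
  have sum_h: "(\<Sum>l\<in>L. h l) = \<rho> * \<tau> * S"
  proof -
    have "(\<Sum>l\<in>L. h l) = (\<Sum>k\<in>L. f k * real (\<Sum>l\<in>L. meets k l))"
      unfolding h_def by (subst sum.swap) (simp add: sum_distrib_left meets_commute mult.commute)
    also have "\<dots> = (\<Sum>k\<in>L. f k * (\<rho> * \<tau>))"
      by (intro sum.cong) (simp_all only: sum_meets \<rho>_def \<tau>_def of_nat_mult)
    finally show ?thesis by (simp add: S_def sum_distrib_right[symmetric])
  qed
  have sum_h2: "(\<Sum>l\<in>L. (h l)\<^sup>2) = \<sigma> * Q + \<rho> * S\<^sup>2"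
  proof -
    have "(\<Sum>l\<in>L. (h l)\<^sup>2) = (\<Sum>l\<in>L. (\<Sum>k\<in>L. meets l k * f k) * h l)"
      by (simp add: h_def power2_eq_square)
    also have "\<dots> = (\<Sum>l\<in>L. \<Sum>k\<in>L. f k * (meets k l * h l))"
      unfolding sum_distrib_right
      by (intro sum.cong refl) (simp add: meets_commute)
    also have "\<dots> = (\<Sum>k\<in>L. f k * (\<Sum>l\<in>L. meets k l * h l))"
      by (subst sum.swap) (simp add: sum_distrib_left)
    also have "\<dots> = (\<Sum>k\<in>L. f k * (\<sigma> * h k + \<rho> * S))"
    proof (rule sum.cong)
      fix k assume k: "k \<in> L"
      have "(\<Sum>l\<in>L. meets k l * h l) = (\<Sum>l\<in>L. \<Sum>j\<in>L. meets k l * (meets l j * f j))"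
        by (simp add: h_def sum_distrib_left)
      also have "\<dots> = (\<Sum>j\<in>L. real (\<Sum>l\<in>L. meets k l * meets l j) * f j)"
        by (subst sum.swap) (simp add: sum_distrib_right mult.assoc)
      also have "\<dots> = (\<Sum>j\<in>L. (\<sigma> * meets k j + \<rho>) * f j)"
        by (intro sum.cong)
          (simp_all only: sum_meets_meets[OF k] \<sigma>_def \<rho>_def of_nat_mult of_nat_add[of "_ * _"])
      also have "\<dots> = \<sigma> * h k + \<rho> * S"
        unfolding h_def S_def sum_distrib_left sum.distrib[symmetric]
        by (intro sum.cong refl) (simp add: algebra_simps)
      finally show "f k * (\<Sum>l\<in>L. meets k l * h l) = f k * (\<sigma> * h k + \<rho> * S)" by simp
    qed simp
    also have "\<dots> = \<sigma> * Q + (\<Sum>k\<in>L. f k) * (\<rho> * S)"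
      unfolding Q_def sum_distrib_left sum_distrib_right sum.distrib[symmetric]
      by (intro sum.cong refl) (simp add: algebra_simps)
    finally show ?thesis by (simp add: S_def[symmetric] power2_eq_square)
  qed
  have card_L: "real (card L) = \<tau> * (\<rho> * \<tau> - \<sigma>)"
    unfolding card_lines[OF assms] by (simp add: \<sigma>_def \<tau>_def \<rho>_def algebra_simps)
  define c where "c = S / \<tau>"
  have Sc: "S = \<tau> * c" using pos by (simp add: c_def)
  \<comment> \<open>The summands are the squares of the values of \<open>M f\<close>.\<close>
  have "0 \<le> (\<Sum>l\<in>L. (\<sigma> * f l - h l + c)\<^sup>2)"
    by (simp add: sum_nonneg)
  also have "\<dots> = (\<Sum>l\<in>L. \<sigma>\<^sup>2 * (f l)\<^sup>2 + (h l)\<^sup>2 + c\<^sup>2 - 2 * \<sigma> * (f l * h l)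
      + 2 * \<sigma> * c * f l - 2 * c * h l)"
    by (intro sum.cong refl) (simp add: power2_eq_square algebra_simps)
  also have "\<dots> = \<sigma>\<^sup>2 * N + (\<Sum>l\<in>L. (h l)\<^sup>2) + card L * c\<^sup>2
      - 2 * \<sigma> * Q + 2 * \<sigma> * c * S - 2 * c * (\<Sum>l\<in>L. h l)"
    by (simp only: sum.distrib sum_subtractf sum_distrib_left[symmetric] sum_constant
        N_def Q_def S_def)
  also have "\<dots> = \<sigma> * (\<sigma> * N - Q + c * S)"
    unfolding sum_h sum_h2 card_L unfolding Sc by (simp add: power2_eq_square algebra_simps)
  finally have "\<sigma> * 0 \<le> \<sigma> * (\<sigma> * N - Q + c * S)" by (simp only: mult_zero_right)
  then have "0 \<le> \<sigma> * N - Q + c * S" by (simp only: mult_le_cancel_left_pos[OF pos(1)])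
  then have "0 \<le> \<tau> * (\<sigma> * N - Q + c * S)" using pos(2) by (intro mult_nonneg_nonneg) simp_all
  also have "\<dots> = \<tau> * \<sigma> * N - \<tau> * Q + S\<^sup>2"
    unfolding Sc by (simp add: power2_eq_square algebra_simps)
  finally have "\<tau> * Q \<le> \<tau> * \<sigma> * N + S\<^sup>2" by simp
  then show ?thesis unfolding \<tau>_def \<sigma>_def Q_def N_def S_def h_def of_nat_mult .
qed

text \<open>
  Evaluate the quadratic form at \<open>a\<close> times the indicator of \<open>X\<close> plus \<open>b\<close> times that of \<open>Y\<close>. With
  \<open>m\<close> and \<open>n\<close> the numbers of lines in \<open>X\<close> and \<open>Y\<close>, \<open>u = t\<^sup>2 - 1 + m\<close> and \<open>v = t\<^sup>2 - 1 + n\<close>, this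
  is a binary form in \<open>a\<close> and \<open>b\<close> whose determinant condition reads \<open>t\<^sup>2 m n \<le> u v\<close>; the
  difference of the two sides has the factor \<open>t\<^sup>2 - 1\<close>, and the other factor is
  \<open>t\<^sup>2 - (m - 1) (n - 1)\<close>.
\<close>

lemma grid_inequality:
  assumes t: "1 < t" and sub: "X \<subseteq> L" "Y \<subseteq> L" and disj: "X \<inter> Y = {}"
    and X: "\<And>l m. l \<in> X \<Longrightarrow> m \<in> X \<Longrightarrow> l \<noteq> m \<Longrightarrow> pts l \<inter> pts m = {}"
    and Y: "\<And>l m. l \<in> Y \<Longrightarrow> m \<in> Y \<Longrightarrow> l \<noteq> m \<Longrightarrow> pts l \<inter> pts m = {}"
    and XY: "\<And>l m. l \<in> X \<Longrightarrow> m \<in> Y \<Longrightarrow> pts l \<inter> pts m \<noteq> {}"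
  shows "(card X - 1) * (card Y - 1) \<le> t\<^sup>2"
proof (cases "X = {} \<or> Y = {}")
  case False
  have fin: "finite X" "finite Y" using sub finite_lines finite_subset by blast+
  define m n where "m = real (card X)" and "n = real (card Y)"
  have m0: "1 \<le> m" and n0: "1 \<le> n"
    using False fin by (simp_all add: m_def n_def Suc_le_eq card_gt_0_iff)
  define u v where "u = (real t)\<^sup>2 - 1 + m" and "v = (real t)\<^sup>2 - 1 + n"
  \<comment> \<open>This choice turns the value of the binary form into a positive multiple of its determinant.\<close>
  define a b where "a = t * n" and "b = u"
  define f where "f l = a * of_bool (l \<in> X) + b * of_bool (l \<in> Y)" for l
  have sumX: "(\<Sum>l\<in>L. of_bool (l \<in> X) * w l) = (\<Sum>l\<in>X. w l)"
    and sumY: "(\<Sum>l\<in>L. of_bool (l \<in> Y) * w l) = (\<Sum>l\<in>Y. w l)" for w :: "'l \<Rightarrow> real"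
    by (rule sum.mono_neutral_cong_right; use sub finite_lines in auto)+
  have f_sum: "(\<Sum>l\<in>L. f l * w l) = a * (\<Sum>l\<in>X. w l) + b * (\<Sum>l\<in>Y. w l)" for w
    unfolding f_def sumX[symmetric] sumY[symmetric]
    unfolding sum_distrib_left sum.distrib[symmetric]
    by (intro sum.cong refl) (simp add: algebra_simps)
  have fX: "f l = a" if "l \<in> X" for l using that disj by (auto simp: f_def)
  have fY: "f l = b" if "l \<in> Y" for l using that disj by (auto simp: f_def)
  have S: "(\<Sum>l\<in>L. f l) = a * m + b * n"
    using f_sum[of "\<lambda>_. 1"] by (simp add: m_def n_def)
  have N: "(\<Sum>l\<in>L. (f l)\<^sup>2) = a\<^sup>2 * m + b\<^sup>2 * n"
    using f_sum[of f] by (simp add: fX fY m_def n_def power2_eq_square)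
  have self: "(\<Sum>k\<in>Z. real (meets l k)) = s + 1"
    if "l \<in> Z" "Z \<subseteq> L" "finite Z"
      and "\<And>l m. l \<in> Z \<Longrightarrow> m \<in> Z \<Longrightarrow> l \<noteq> m \<Longrightarrow> pts l \<inter> pts m = {}" for l Z
  proof -
    have "(\<Sum>k\<in>Z. real (meets l k)) = (\<Sum>k\<in>Z. if k = l then real (s + 1) else 0)"
    proof (rule sum.cong)
      fix k assume "k \<in> Z"
      with that show "real (meets l k) = (if k = l then real (s + 1) else 0)"
        by (cases "k = l") (auto simp: meets_self subset_iff, auto simp: meets_def)
    qed simp
    then show ?thesis using that by simp
  qed
  have cross: "meets l k = 1" "meets k l = 1" if "l \<in> X" "k \<in> Y" for l k
    using that sub disj XY[OF that] meets_distinct[of l k] meets_commute[of l k] by auto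
  have hX: "(\<Sum>k\<in>L. meets l k * f k) = a * (s + 1) + b * n" if l: "l \<in> X" for l
  proof -
    have "(\<Sum>k\<in>L. meets l k * f k) = a * (\<Sum>k\<in>X. real (meets l k)) + b * (\<Sum>k\<in>Y. real (meets l k))"
      using f_sum[of "\<lambda>k. real (meets l k)"] by (simp add: mult.commute)
    then show ?thesis using self[OF l sub(1) fin(1) X] cross(1)[OF l] by (simp add: n_def)
  qed
  have hY: "(\<Sum>k\<in>L. meets l k * f k) = a * m + b * (s + 1)" if l: "l \<in> Y" for l
  proof -
    have "(\<Sum>k\<in>L. meets l k * f k) = a * (\<Sum>k\<in>X. real (meets l k)) + b * (\<Sum>k\<in>Y. real (meets l k))"
      using f_sum[of "\<lambda>k. real (meets l k)"] by (simp add: mult.commute)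
    then show ?thesis using self[OF l sub(2) fin(2) Y] cross(2)[OF _ l] by (simp add: m_def)
  qed
  have Q: "(\<Sum>l\<in>L. f l * (\<Sum>k\<in>L. meets l k * f k))
      = a * (m * (a * (s + 1) + b * n)) + b * (n * (a * m + b * (s + 1)))"
    unfolding f_sum by (simp add: hX hY m_def n_def)
  have "L \<noteq> {}" using False sub by blast
  from meets_form_bound[OF this, of f]
  have "0 \<le> (t + 1) * (s + t) * (a\<^sup>2 * m + b\<^sup>2 * n) + (a * m + b * n)\<^sup>2
     - (t + 1) * (a * (m * (a * (s + 1) + b * n)) + b * (n * (a * m + b * (s + 1))))"
    unfolding Q S N by simp
  also have "\<dots> = m * a\<^sup>2 * u + n * b\<^sup>2 * v - 2 * t * m * n * a * b"
    by (simp add: u_def v_def power2_eq_square algebra_simps)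
  also have "\<dots> = (n * u) * (u * v - t\<^sup>2 * m * n)"
    by (simp add: a_def b_def power2_eq_square algebra_simps)
  finally have ge: "0 \<le> (n * u) * (u * v - t\<^sup>2 * m * n)" .
  have t2: "1 < (real t)\<^sup>2" using t by (simp add: one_less_power)
  then have "0 < n * u" using m0 n0 by (simp add: u_def)
  then have "0 \<le> u * v - t\<^sup>2 * m * n" using ge by (simp add: zero_le_mult_iff)
  also have "\<dots> = ((real t)\<^sup>2 - 1) * ((real t)\<^sup>2 - (m - 1) * (n - 1))"
    by (simp add: u_def v_def power2_eq_square algebra_simps)
  finally have "(m - 1) * (n - 1) \<le> (real t)\<^sup>2"
    using t2 by (simp add: zero_le_mult_iff)
  then have "real ((card X - 1) * (card Y - 1)) \<le> real (t\<^sup>2)"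
    using m0 n0 by (simp add: m_def n_def of_nat_diff)
  then show ?thesis by (simp only: of_nat_le_iff)
qed auto

end

section \<open>The action of the automorphism on the lines\<close>

locale prime_order_automorphism = thick_finite_generalized_quadrangle P L I s t
  for P :: "'p set" and L :: "'l set" and I :: "('p \<times> 'l) set" and s t :: nat +
  fixes g :: "'p \<Rightarrow> 'p"
  assumes automorphism: "g \<in> gq_automorphisms P L I"
    and t_less_s: "t < s"
    and prime_Suc_s: "Factorial_Ring.prime (s + 1)"
    and period: "\<And>x. x \<in> P \<Longrightarrow> (g ^^ (s + 1)) x = x"
    and nontrivial: "\<exists>x\<in>P. g x \<noteq> x"
begin

lemma g_closed: "x \<in> P \<Longrightarrow> g x \<in> P"
  using automorphism by (auto simp: gq_automorphisms_def dest: Bij_imp_funcset)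

lemma g_inj: "inj_on g P"
  using automorphism by (simp add: gq_automorphisms_def Bij_def bij_betw_def)

lemma g_collinear:
  assumes "l \<in> L" "x \<in> pts l" "y \<in> pts l"
  obtains m where "m \<in> L" "g x \<in> pts m" "g y \<in> pts m"
proof -
  have xy: "x \<in> P" "y \<in> P" using assms pts_subset by auto
  have "collinear_points L I x y" using assms xy by (auto simp: collinear_points_iff)
  then have "collinear_points L I (g x) (g y)"
    using automorphism xy by (simp add: gq_automorphisms_def)
  then show ?thesis using that g_closed xy by (auto simp: collinear_points_iff)
qed

text \<open>
  Automorphisms are only assumed to preserve collinearity of points. As there are no triangles, a
  point collinear with two distinct points of a line lies on that line: once two points of \<open>l\<close> are
  mapped into a line, the others are mapped into it too.
\<close>

lemma image_of_line:
  assumes l: "l \<in> L"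
  shows "\<exists>m\<in>L. pts m = g ` pts l"
proof -
  have inj: "inj_on g (pts l)" using g_inj pts_subset inj_on_subset by blast
  obtain x y where xy: "x \<in> pts l" "y \<in> pts l" "x \<noteq> y"
    using two_points_on_line[OF l] by blast
  then obtain m where m: "m \<in> L" "g x \<in> pts m" "g y \<in> pts m"
    using g_collinear[OF l] by blast
  have gxy: "g x \<noteq> g y" using inj xy by (auto dest: inj_onD)
  have "g z \<in> pts m" if z: "z \<in> pts l" for z
  proof -
    obtain m1 where m1: "m1 \<in> L" "g z \<in> pts m1" "g x \<in> pts m1"
      using g_collinear[OF l z xy(1)] by blast
    obtain m2 where m2: "m2 \<in> L" "g z \<in> pts m2" "g y \<in> pts m2"
      using g_collinear[OF l z xy(2)] by blast
    show ?thesis by (rule no_triangle[OF m(1) m1(1) m2(1) m(2,3) m1(2,3) m2(2,3) gxy])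
  qed
  then have "g ` pts l \<subseteq> pts m" by blast
  moreover have "card (g ` pts l) = card (pts m)"
    using card_image[OF inj] card_pts l m(1) by simp
  ultimately have "pts m = g ` pts l" using card_subset_eq[OF finite_pts] by metis
  then show ?thesis using m(1) by blast
qed

text \<open>
  The action of \<open>g\<close> on lines; it is well defined because a line is determined by its points.
\<close>

definition line_map :: "'l \<Rightarrow> 'l" where
  "line_map l = (THE m. m \<in> L \<and> pts m = g ` pts l)"

lemma line_map:
  assumes "l \<in> L"
  shows "line_map l \<in> L" "pts (line_map l) = g ` pts l"
proof -
  have "\<exists>!m. m \<in> L \<and> pts m = g ` pts l"
    using image_of_line[OF assms] pts_inj by (auto intro!: ex_ex1I)
  from theI'[OF this] show "line_map l \<in> L" "pts (line_map l) = g ` pts l"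
    by (simp_all add: line_map_def)
qed

lemma line_map_funpow_closed: "l \<in> L \<Longrightarrow> (line_map ^^ i) l \<in> L"
  by (rule funpow_closed[OF line_map(1)])

lemma pts_line_map_funpow: "l \<in> L \<Longrightarrow> pts ((line_map ^^ i) l) = (g ^^ i) ` pts l"
  by (induction i) (simp_all add: line_map line_map_funpow_closed image_comp)

lemma line_map_period:
  assumes l: "l \<in> L"
  shows "(line_map ^^ (s + 1)) l = l"
proof (rule pts_inj)
  have "(g ^^ (s + 1)) ` pts l = (\<lambda>x. x) ` pts l"
    using period pts_subset by (intro image_cong refl) blast
  then show "pts ((line_map ^^ (s + 1)) l) = pts l"
    using pts_line_map_funpow[OF l, of "s + 1"] by simp
qed (use l line_map_funpow_closed in blast)+

text \<open>
  First the lines on \<open>x\<close>, of which there are \<open>t + 1 < s + 1\<close>, are fixed, and then the \<open>s\<close> points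
  other than \<open>x\<close> of each of these lines.
\<close>

lemma fixed_point_spreads:
  assumes x: "x \<in> P" "g x = x" and l: "l \<in> L" "x \<in> pts l" and y: "y \<in> pts l"
  shows "g y = y"
proof (cases "y = x")
  case False
  have "line_map l = l"
  proof (rule small_invariant_set_fixed[OF prime_Suc_s finite_pencil])
    show "card (pencil x) < s + 1" using card_pencil[OF x(1)] t_less_s by simp
    show "line_map k \<in> pencil x" if "k \<in> pencil x" for k
    proof -
      have k: "k \<in> L" "x \<in> pts k" using that x(1) by (auto simp: pencil_def pts_def)
      then have "x \<in> pts (line_map k)" using x(2) line_map(2)[OF k(1)] by force
      then show ?thesis using mem_pencil_iff[OF x(1) line_map(1)[OF k(1)]] by simp
    qed
    show "(line_map ^^ (s + 1)) k = k" if "k \<in> pencil x" for k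
      using that line_map_period by (simp add: pencil_def)
    show "l \<in> pencil x" using l x(1) by (simp add: mem_pencil_iff)
  qed
  then have gl: "g ` pts l = pts l" using line_map(2)[OF l(1)] by simp
  show ?thesis
  proof (rule small_invariant_set_fixed[OF prime_Suc_s, of "pts l - {x}"])
    show "card (pts l - {x}) < s + 1" using card_pts[OF l(1)] l(2) by simp
    show "g z \<in> pts l - {x}" if z: "z \<in> pts l - {x}" for z
    proof -
      have "z \<in> P" "z \<noteq> x" using z pts_subset by auto
      then have "g z \<noteq> g x" using g_inj x(1) by (auto dest: inj_onD)
      then show ?thesis using z gl x(2) by auto
    qed
    show "(g ^^ (s + 1)) z = z" if "z \<in> pts l - {x}" for z
      using that period pts_subset by blast
  qed (use y False in auto)
qed (use x in simp)

text \<open>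
  A fixed point makes all points of some line fixed, and every point is collinear with one of
  these.
\<close>

lemma no_fixed_point:
  assumes x: "x \<in> P"
  shows "g x \<noteq> x"
proof
  assume fix_x: "g x = x"
  have "pencil x \<noteq> {}" using card_pencil[OF x] by auto
  then obtain l where l: "l \<in> L" "x \<in> pts l" using x by (auto simp: pencil_def pts_def)
  have "g y = y" if y: "y \<in> P" for y
  proof (cases "y \<in> pts l")
    case True
    then show ?thesis by (rule fixed_point_spreads[OF x fix_x l])
  next
    case False
    obtain z m where zm: "m \<in> L" "y \<in> pts m" "z \<in> pts m" "z \<in> pts l"
      using projection_exists[OF y l(1) False] by blast
    have "z \<in> P" using zm(3) pts_subset by blast
    moreover have "g z = z" by (rule fixed_point_spreads[OF x fix_x l zm(4)])
    ultimately show ?thesis using fixed_point_spreads zm by blast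
  qed
  then show False using nontrivial by blast
qed

section \<open>The number of fixed lines\<close>

definition fixed_lines :: "'l set" where
  "fixed_lines = {l \<in> L. line_map l = l}"

lemma finite_fixed_lines [simp]: "finite fixed_lines"
  using finite_lines by (simp add: fixed_lines_def)

lemma fixed_line_funpow: "l \<in> fixed_lines \<Longrightarrow> (line_map ^^ i) l = l"
  by (induction i) (simp_all add: fixed_lines_def)

lemma fixed_line_point_closed:
  assumes "l \<in> fixed_lines" "x \<in> pts l"
  shows "(g ^^ i) x \<in> pts l"
proof -
  have "l \<in> L" using assms by (simp add: fixed_lines_def)
  from pts_line_map_funpow[OF this, of i] show ?thesis
    using fixed_line_funpow[OF assms(1)] assms(2) by auto
qed

text \<open>
  A common point \<open>x\<close> of two fixed lines would have its image \<open>g x \<noteq> x\<close> on both lines as well.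
\<close>

lemma fixed_lines_disjoint:
  assumes l: "l \<in> fixed_lines" and m: "m \<in> fixed_lines" and ne: "l \<noteq> m"
  shows "pts l \<inter> pts m = {}"
proof (rule ccontr)
  assume "pts l \<inter> pts m \<noteq> {}"
  then obtain x where x: "x \<in> pts l" "x \<in> pts m" by blast
  have gx: "g x \<in> pts l" "g x \<in> pts m"
    using fixed_line_point_closed[OF l x(1), of 1] fixed_line_point_closed[OF m x(2), of 1] by simp_all
  have "g x \<noteq> x" using no_fixed_point x(1) pts_subset by blast
  then show False
    using lines_eqI[of l m x "g x"] x gx l m ne by (auto simp: fixed_lines_def)
qed

lemma lines_nonempty: "L \<noteq> {}"
proof -
  obtain x where "x \<in> P" using nontrivial by blast
  then have "pencil x \<noteq> {}" using card_pencil by fastforce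
  then show ?thesis by (auto simp: pencil_def)
qed

text \<open>
  This rests on \<open>(t + 1) (s t + 1) + t\<^sup>2 = (t\<^sup>2 + t) (s + 1) + 1\<close>.
\<close>

lemma card_fixed_lines:
  obtains k where "card fixed_lines + t\<^sup>2 = k * (s + 1) + 1"
proof -
  have "[card fixed_lines = card L] (mod (s + 1))"
    unfolding fixed_lines_def
    by (rule card_fixed_cong_card[OF prime_Suc_s finite_lines line_map(1) line_map_period])
  then have "[card fixed_lines + t\<^sup>2 = card L + t\<^sup>2] (mod (s + 1))"
    by (simp only: cong_add_rcancel_nat)
  also have "card L + t\<^sup>2 = (t\<^sup>2 + t) * (s + 1) + 1"
    by (simp add: card_lines[OF lines_nonempty] power2_eq_square algebra_simps)
  also have "[(t\<^sup>2 + t) * (s + 1) + 1 = 1] (mod (s + 1))"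
    by (simp only: cong_def mod_mult_self3)
  finally have "[card fixed_lines + t\<^sup>2 = 1] (mod (s + 1))" .
  moreover have "1 \<le> card fixed_lines + t\<^sup>2" using t_pos by (simp add: Suc_le_eq)
  ultimately show ?thesis using that cong_le_nat by blast
qed

text \<open>
  Otherwise \<open>s + 1\<close> would divide \<open>(t - 1) (t + 1)\<close>, whose factors are positive and smaller than
  the prime \<open>s + 1\<close>.
\<close>

lemma fixed_line_exists: "fixed_lines \<noteq> {}"
proof
  assume none: "fixed_lines = {}"
  obtain k where "card fixed_lines + t\<^sup>2 = k * (s + 1) + 1" by (rule card_fixed_lines)
  then have "k * (s + 1) = t * t - 1" using none by (simp add: power2_eq_square)
  also have "\<dots> = (t - 1) * (t + 1)" by (simp add: algebra_simps)
  finally have "s + 1 dvd (t - 1) * (t + 1)" by (metis dvd_triv_right)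
  then have "s + 1 dvd t - 1 \<or> s + 1 dvd t + 1" using prime_Suc_s by (simp only: prime_dvd_mult_iff)
  then show False using t_gt_1 t_less_s by (auto dest: dvd_imp_le)
qed

text \<open>
  The images of \<open>m\<close> under the powers of \<open>g\<close> form one class of a grid, and the other class consists
  of \<open>l0\<close> and the other fixed lines meeting \<open>m\<close>. Two distinct images of \<open>m\<close> cannot meet, as
  together with \<open>l0\<close> they would form a triangle.
\<close>

lemma transversal_bound:
  assumes l0: "l0 \<in> fixed_lines" and m: "m \<in> L" "m \<noteq> l0" and x: "x \<in> pts m" "x \<in> pts l0"
  shows "s * card {l \<in> fixed_lines - {l0}. pts l \<inter> pts m \<noteq> {}} \<le> t\<^sup>2"
proof -
  define R where "R = {l \<in> fixed_lines - {l0}. pts l \<inter> pts m \<noteq> {}}"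
  define M where "M i = (line_map ^^ i) m" for i
  define X where "X = M ` {..<s + 1}"
  have xP: "x \<in> P" and l0L: "l0 \<in> L" using x pts_subset l0 by (auto simp: fixed_lines_def)
  have M: "M i \<in> L" "pts (M i) = (g ^^ i) ` pts m" for i
    using m by (simp_all add: M_def line_map_funpow_closed pts_line_map_funpow)
  have m_moves: "line_map m \<noteq> m"
    using fixed_lines_disjoint[OF l0, of m] m x by (auto simp: fixed_lines_def)
  have M_moves: "M i \<notin> fixed_lines" if i: "i < s + 1" for i
  proof
    assume fixed: "M i \<in> fixed_lines"
    have "m = (line_map ^^ (s + 1 - i + i)) m" using line_map_period[OF m(1)] i by simp
    also have "\<dots> = (line_map ^^ (s + 1 - i)) (M i)"
      unfolding M_def funpow_add by simp
    also have "\<dots> = M i" by (rule fixed_line_funpow[OF fixed])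
    finally have "m = M i" .
    then show False using fixed m_moves by (simp add: fixed_lines_def)
  qed
  have on_M: "(g ^^ i) x \<in> pts (M i)" and on_l0: "(g ^^ i) x \<in> pts l0" for i
    using M(2) x fixed_line_point_closed[OF l0] by auto
  have M_disjoint: "pts (M i) \<inter> pts (M j) = {}" if ij: "i < s + 1" "j < s + 1" "i \<noteq> j" for i j
  proof (rule ccontr)
    assume "pts (M i) \<inter> pts (M j) \<noteq> {}"
    then obtain z where z: "z \<in> pts (M i)" "z \<in> pts (M j)" by blast
    have ne: "(g ^^ i) x \<noteq> (g ^^ j) x"
      using inj_on_funpow_prime_period[OF prime_Suc_s period[OF xP] no_fixed_point[OF xP]] ij
      by (auto dest: inj_onD)
    show False
    proof (cases "z \<in> pts l0")
      case True
      have "z = (g ^^ k) x" if "k < s + 1" "z \<in> pts (M k)" for k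
        using lines_eqI[OF M(1) l0L that(2) True on_M on_l0] M_moves[OF that(1)] l0 by metis
      then show False using ne ij z by metis
    next
      case False
      show False
        using projection_unique[OF l0L False M(1) z(1) on_M on_l0 M(1) z(2) on_M on_l0] ne by blast
    qed
  qed
  have card_X: "card X = s + 1"
    unfolding X_def M_def
    using card_image[OF inj_on_funpow_prime_period[OF prime_Suc_s line_map_period[OF m(1)] m_moves]]
    by simp
  have Y_fixed: "insert l0 R \<subseteq> fixed_lines" using l0 by (auto simp: R_def)
  have "(card X - 1) * (card (insert l0 R) - 1) \<le> t\<^sup>2"
  proof (rule grid_inequality[OF t_gt_1])
    show "X \<subseteq> L" using M(1) by (auto simp: X_def)
    show "insert l0 R \<subseteq> L" using Y_fixed by (auto simp: fixed_lines_def)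
    show "X \<inter> insert l0 R = {}" using Y_fixed M_moves by (auto simp: X_def)
    show "pts k \<inter> pts l = {}" if "k \<in> X" "l \<in> X" "k \<noteq> l" for k l
      using that M_disjoint unfolding X_def by blast
    show "pts k \<inter> pts l = {}" if "k \<in> insert l0 R" "l \<in> insert l0 R" "k \<noteq> l" for k l
      using that Y_fixed fixed_lines_disjoint by blast
    show "pts k \<inter> pts l \<noteq> {}" if k: "k \<in> X" and l: "l \<in> insert l0 R" for k l
    proof -
      obtain i where i: "k = M i" using k by (auto simp: X_def)
      obtain y where y: "y \<in> pts l" "y \<in> pts m"
        using l x by (auto simp: R_def)
      have "(g ^^ i) y \<in> pts l" using fixed_line_point_closed Y_fixed l y(1) by blast
      moreover have "(g ^^ i) y \<in> pts k" using M(2) i y(2) by blast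
      ultimately show ?thesis by blast
    qed
  qed
  moreover have "card (insert l0 R) = card R + 1"
    by (simp add: R_def)
  ultimately show ?thesis using card_X by (simp add: R_def)
qed

text \<open>
  Each fixed line other than \<open>l0\<close> meets one of the \<open>t\<close> lines other than \<open>l0\<close> on a chosen point
  \<open>x\<close> of \<open>l0\<close>; the pigeonhole principle selects a line meeting many of them.
\<close>

lemma few_fixed_lines:
  obtains n where "card fixed_lines \<le> t * n + 1" "s * n \<le> t\<^sup>2"
proof -
  obtain l0 where l0: "l0 \<in> fixed_lines" using fixed_line_exists by blast
  then have l0L: "l0 \<in> L" by (simp add: fixed_lines_def)
  obtain x where x: "x \<in> pts l0" using two_points_on_line[OF l0L] by blast
  have xP: "x \<in> P" using x pts_subset by blast
  define T where "T = pencil x - {l0}"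
  define R where "R m = {l \<in> fixed_lines - {l0}. pts l \<inter> pts m \<noteq> {}}" for m
  have T: "m \<in> L" "m \<noteq> l0" "x \<in> pts m" if "m \<in> T" for m
    using that xP by (auto simp: T_def pencil_def pts_def)
  have card_T: "card T = t"
    using card_pencil[OF xP] x xP l0L by (simp add: T_def mem_pencil_iff)
  have fin_T: "finite T" by (simp add: T_def)
  have T_ne: "T \<noteq> {}" using card_T t_pos by auto
  have cover: "fixed_lines - {l0} \<subseteq> (\<Union>m\<in>T. R m)"
  proof
    fix l assume l: "l \<in> fixed_lines - {l0}"
    then have lL: "l \<in> L" and disj: "pts l0 \<inter> pts l = {}"
      using fixed_lines_disjoint[OF l0, of l] by (auto simp: fixed_lines_def)
    then have "x \<notin> pts l" using x by blast
    then obtain y m where ym: "m \<in> L" "x \<in> pts m" "y \<in> pts m" "y \<in> pts l"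
      using projection_exists[OF xP lL] by blast
    then have "m \<in> T" using disj xP by (auto simp: T_def mem_pencil_iff)
    moreover have "l \<in> R m" using l ym by (auto simp: R_def)
    ultimately show "l \<in> (\<Union>m\<in>T. R m)" by blast
  qed
  define n where "n = Max ((\<lambda>m. card (R m)) ` T)"
  have "card (fixed_lines - {l0}) \<le> card (\<Union>m\<in>T. R m)"
    by (rule card_mono[OF _ cover]) (simp add: fin_T R_def)
  also have "\<dots> \<le> (\<Sum>m\<in>T. card (R m))" by (rule card_UN_le[OF fin_T])
  also have "\<dots> \<le> of_nat (card T) * n"
    by (rule sum_bounded_above) (simp add: n_def fin_T)
  finally have "card fixed_lines \<le> t * n + 1"
    using l0 by (simp add: card_T card_Diff_singleton_if)
  moreover have "n \<in> (\<lambda>m. card (R m)) ` T"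
    unfolding n_def using fin_T T_ne by (intro Max_in) auto
  then have "s * n \<le> t\<^sup>2"
    using transversal_bound[OF l0 T(1,2,3) x] by (auto simp: R_def)
  ultimately show ?thesis by (rule that)
qed

lemma automorphism_inequality:
  "int s * \<lceil>real_of_int \<lceil>(real t)^2 / (real s + 1)\<rceil> * ((real s + 1) / real t)\<rceil>
    \<le> int t * (int s + int t)"
proof -
  obtain k where k: "card fixed_lines + t\<^sup>2 = k * (s + 1) + 1" by (rule card_fixed_lines)
  obtain n where n: "card fixed_lines \<le> t * n + 1" "s * n \<le> t\<^sup>2" by (rule few_fixed_lines)
  have "1 \<le> card fixed_lines"
    using fixed_line_exists by (simp add: Suc_le_eq card_gt_0_iff)
  with k n have "t\<^sup>2 \<le> k * (s + 1)" "k * (s + 1) \<le> t * (t + n)"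
    by (simp_all add: power2_eq_square algebra_simps)
  then have "real (t\<^sup>2) \<le> real (k * (s + 1))" "real (k * (s + 1)) \<le> real (t * (t + n))"
    by (simp_all only: of_nat_le_iff)
  then have bounds: "(real t)\<^sup>2 \<le> real k * (real s + 1)"
      "real k * (real s + 1) \<le> real t * (real t + real n)"
    by (simp_all add: algebra_simps)
  define K where "K = \<lceil>(real t)\<^sup>2 / (real s + 1)\<rceil>"
  have "(real t)\<^sup>2 / (real s + 1) \<le> real k"
    using bounds(1) by (simp add: pos_divide_le_eq)
  then have "K \<le> int k"
    unfolding K_def by (simp only: ceiling_le_iff of_int_of_nat_eq)
  then have "real_of_int K \<le> real k" by linarith
  then have "real_of_int K * ((real s + 1) / real t) \<le> real k * ((real s + 1) / real t)"
    by (intro mult_right_mono) simp_all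
  also have "\<dots> \<le> real t + real n"
    using bounds(2) t_pos by (simp add: pos_divide_le_eq mult.commute)
  finally have "\<lceil>real_of_int K * ((real s + 1) / real t)\<rceil> \<le> int (t + n)"
    by (simp add: ceiling_le_iff)
  then have "int s * \<lceil>real_of_int K * ((real s + 1) / real t)\<rceil> \<le> int s * int (t + n)"
    by (intro mult_left_mono) simp_all
  also have "\<dots> = int (s * t + s * n)" by (simp add: algebra_simps)
  also have "\<dots> \<le> int (s * t + t\<^sup>2)" using n(2) by (simp only: of_nat_le_iff add_left_mono)
  also have "\<dots> = int t * (int s + int t)" by (simp add: power2_eq_square algebra_simps)
  finally show ?thesis unfolding K_def .
qed

end

section \<open>From the automorphism group to iterates\<close>

lemma gq_AutoGroup_pow_apply:
  fixes n :: nat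
  assumes g: "g \<in> carrier (gq_AutoGroup P L I)" and "x \<in> P"
  shows "(g [^]\<^bsub>gq_AutoGroup P L I\<^esub> n) x = (g ^^ n) x"
  using assms(2)
proof (induction n arbitrary: x)
  case 0
  then show ?case by (simp add: gq_AutoGroup_def BijGroup_def)
next
  case (Suc n)
  interpret G: group "gq_AutoGroup P L I" by (rule group_gq_AutoGroup)
  have "g [^]\<^bsub>gq_AutoGroup P L I\<^esub> n \<in> carrier (gq_AutoGroup P L I)"
    using g by simp
  then have "(g [^]\<^bsub>gq_AutoGroup P L I\<^esub> Suc n) x = (g [^]\<^bsub>gq_AutoGroup P L I\<^esub> n) (g x)"
    using g Suc.prems
    by (simp add: gq_AutoGroup_def gq_automorphisms_def BijGroup_def compose_eq)
  moreover have "g x \<in> P"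
    using g Suc.prems
    by (auto simp: gq_AutoGroup_def gq_automorphisms_def dest: Bij_imp_funcset)
  ultimately show ?case using Suc.IH by (simp add: funpow_swap1)
qed

theorem theorem1p1:
  fixes P :: "'p set" and L :: "'l set" and I :: "('p \<times> 'l) set" and s t :: nat
  assumes "thick_finite_generalized_quadrangle P L I s t"
    and "s > t"
    and "Factorial_Ring.prime (s + 1)"
    and "\<exists>g \<in> carrier (gq_AutoGroup P L I). group.ord (gq_AutoGroup P L I) g = s + 1"
  shows "int s * \<lceil>real_of_int \<lceil>(real t)^2 / (real s + 1)\<rceil> * ((real s + 1) / real t)\<rceil>
           \<le> int t * (int s + int t)"
proof -
  interpret G: group "gq_AutoGroup P L I" by (rule group_gq_AutoGroup)
  interpret Q: thick_finite_generalized_quadrangle P L I s t by (rule assms(1))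
  obtain g where g: "g \<in> carrier (gq_AutoGroup P L I)" "G.ord g = s + 1"
    using assms(4) by blast
  have aut: "g \<in> gq_automorphisms P L I" using g(1) by (simp add: gq_AutoGroup_def)
  have one: "\<one>\<^bsub>gq_AutoGroup P L I\<^esub> = (\<lambda>x\<in>P. x)" by (simp add: gq_AutoGroup_def BijGroup_def)
  have per: "(g ^^ (s + 1)) x = x" if "x \<in> P" for x
    using gq_AutoGroup_pow_apply[OF g(1) that, of "s + 1"] G.pow_ord_eq_1[OF g(1)] g(2) one that
    by simp
  have "\<exists>x\<in>P. g x \<noteq> x"
  proof (rule ccontr)
    assume "\<not> (\<exists>x\<in>P. g x \<noteq> x)"
    moreover have "g \<in> extensional P" using aut by (simp add: gq_automorphisms_def Bij_def)
    ultimately have "g = (\<lambda>x\<in>P. x)" by (auto simp: fun_eq_iff extensional_def)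
    then have "G.ord g = 1" using G.ord_id one by simp
    then show False using g(2) Q.s_pos by simp
  qed
  with aut assms(2,3) per interpret prime_order_automorphism P L I s t g
    by unfold_locales
  show ?thesis by (rule automorphism_inequality)
qed

end
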